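(* Let $d,\lambda,k,a_1,\dots,a_d$ be positive integers, let $n=\prod_{i=1}^d a_i$ and $b_i=n/a_i$ for $i\in[d]$. Let $G=\lambda K_{n\times d}^d$ and fix a $(b_1,\dots,b_d)$-block partition of its vertex classes. If $m_1,\dots,m_k$ are positive integers satisfying $$\sum_{j=1}^k m_j=\lambda n^d,$$ then $G$ has a $k$-coloring such that, for every $j\in[k]$, every $v\in V(G)$, every $(b_1,\dots,b_d)$-block $B$, and every edge $e$ of $K_{n\times d}^d$, $$|E(G(j))|=m_j,\qquad \deg_{G(j)}(v)\approx\frac{m_j}{n},\qquad |E(G(j))\cap E(B)|\approx\frac{m_j}{n},\qquad \mathrm{mult}_{G(j)}(e)\approx\frac{m_j}{n^d}.$$ In particular, for each $j\in[k]$, $G(j)$ is simple if and only if $m_j\le n^d$.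
   Context: Write $[n]=\{1,\dots,n\}$. A hypergraph $G=(V,E)$ consists of a finite vertex set $V$ and a multiset $E$ of subsets of $V$ (edges). $\deg_G(v)$ is the number of edges containing $v$, counted with multiplicity; $\mathrm{mult}_G(e)$ is the multiplicity of the subset $e\subseteq V$ in $E$; $|E(G)|$ counts edges with multiplicity. A hypergraph is simple if it has no repeated edges. A $k$-coloring of $G$ assigns a color in $[k]$ to each edge occurrence (different copies of the same edge may receive different colors); $G(j)$ denotes the spanning subhypergraph consisting of the edge occurrences of color $j$. $K_{n\times d}^d$ is the complete $d$-uniform $d$-partite hypergraph: its vertex set is the disjoint union of classes $V_1,\dots,V_d$, each of size $n$, with one edge for every choice of one vertex from each class. $\lambda G$ is obtained from $G$ by replacing every edge by $\lambda$ copies. A $(b_1,\dots,b_d)$-block partition: each class $V_i$ is partitioned into $a_i$ groups $V_i^1,\dots,V_i^{a_i}$, each of size $b_i$. A $(b_1,\dots,b_d)$-block is the subhypergraph of $\lambda K_{n\times d}^d$ induced by $V_1^{s_1}\cup\dots\cup V_d^{s_d}$ for some choice of $s_i\in[a_i]$, $i\in[d]$ (there are $n$ blocks). $|E(G(j))\cap E(B)|$ is the number of edge occurrences of color $j$ in the block $B$. For real $x,y$, $x\approx y$ means $\lfloor y\rfloor\le x\le\lceil y\rceil$ (this relation is not symmetric). *)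

theory Defs
  imports Complex_Main "HOL-Library.Multiset" "HOL-Library.FuncSet" "HOL-Library.Disjoint_Sets"
begin

record 'v hypergraph =
  verts :: "'v set"
  edges :: "'v set multiset"

definition wf_hypergraph :: "'v hypergraph \<Rightarrow> bool" where
  "wf_hypergraph G \<longleftrightarrow> finite (verts G) \<and> (\<forall>e \<in># edges G. e \<subseteq> verts G)"

definition vertex_degree :: "'v hypergraph \<Rightarrow> 'v \<Rightarrow> nat" where
  "vertex_degree G v = size {#e \<in># edges G. v \<in> e#}"

definition edge_mult :: "'v hypergraph \<Rightarrow> 'v set \<Rightarrow> nat" where
  "edge_mult G e = count (edges G) e"

definition num_edges :: "'v hypergraph \<Rightarrow> nat" where
  "num_edges G = size (edges G)"

definition simple_hypergraph :: "'v hypergraph \<Rightarrow> bool" where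
  "simple_hypergraph G \<longleftrightarrow> (\<forall>e. edge_mult G e \<le> 1)"

text \<open>The copies of an edge \<open>e\<close> of multiplicity \<open>r\<close> are \<open>(e, 0), \<dots>, (e, r - 1)\<close>.\<close>

definition occurrences :: "'v hypergraph \<Rightarrow> ('v set \<times> nat) set" where
  "occurrences G = {(e, c). c < edge_mult G e}"

definition is_coloring :: "'v hypergraph \<Rightarrow> nat \<Rightarrow> ('v set \<times> nat \<Rightarrow> nat) \<Rightarrow> bool" where
  "is_coloring G k f \<longleftrightarrow> (\<forall>p \<in> occurrences G. f p \<in> {1..k})"

definition color_class :: "'v hypergraph \<Rightarrow> ('v set \<times> nat \<Rightarrow> nat) \<Rightarrow> nat \<Rightarrow> 'v hypergraph" where
  "color_class G f j =
     \<lparr>verts = verts G, edges = image_mset fst (mset_set {p \<in> occurrences G. f p = j})\<rparr>"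

definition scale_hypergraph :: "nat \<Rightarrow> 'v hypergraph \<Rightarrow> 'v hypergraph" where
  "scale_hypergraph r G = \<lparr>verts = verts G, edges = repeat_mset r (edges G)\<rparr>"

definition induced_hypergraph :: "'v hypergraph \<Rightarrow> 'v set \<Rightarrow> 'v hypergraph" where
  "induced_hypergraph G S = \<lparr>verts = S, edges = {#e \<in># edges G. e \<subseteq> S#}\<rparr>"

text \<open>The complete \<open>d\<close>-uniform \<open>d\<close>-partite hypergraph on classes \<open>V 1, \<dots>, V d\<close>, which are
  meant to be finite and pairwise disjoint; the function \<open>c\<close> chooses one vertex from each class.\<close>

definition complete_partite :: "nat \<Rightarrow> (nat \<Rightarrow> 'v set) \<Rightarrow> 'v hypergraph" where
  "complete_partite d V =
     \<lparr>verts = (\<Union>i \<in> {1..d}. V i),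
      edges = image_mset (\<lambda>c. c ` {1..d}) (mset_set (\<Pi>\<^sub>E i \<in> {1..d}. V i))\<rparr>"

text \<open>\<open>U i s\<close> is the \<open>s\<close>-th of the \<open>a i\<close> groups of the class \<open>V i\<close>.\<close>

definition block_partition ::
  "nat \<Rightarrow> (nat \<Rightarrow> 'v set) \<Rightarrow> (nat \<Rightarrow> nat) \<Rightarrow> (nat \<Rightarrow> nat) \<Rightarrow> (nat \<Rightarrow> nat \<Rightarrow> 'v set) \<Rightarrow> bool" where
  "block_partition d V a b U \<longleftrightarrow>
     (\<forall>i \<in> {1..d}.
        disjoint_family_on (U i) {1..a i} \<and>
        (\<Union>s \<in> {1..a i}. U i s) = V i \<and>
        (\<forall>s \<in> {1..a i}. card (U i s) = b i))"

definition blocks ::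
  "'v hypergraph \<Rightarrow> nat \<Rightarrow> (nat \<Rightarrow> nat) \<Rightarrow> (nat \<Rightarrow> nat \<Rightarrow> 'v set) \<Rightarrow> 'v hypergraph set" where
  "blocks G d a U =
     {induced_hypergraph G (\<Union>i \<in> {1..d}. U i (s i)) | s. \<forall>i \<in> {1..d}. s i \<in> {1..a i}}"

text \<open>The number of edge occurrences of color \<open>j\<close> in \<open>B\<close>, for \<open>B\<close> an induced subhypergraph
  of \<open>G\<close>. Since \<open>B\<close> contains every copy of each of its edges, its occurrences are occurrences
  of \<open>G\<close>.\<close>

definition color_count_in :: "'v hypergraph \<Rightarrow> ('v set \<times> nat \<Rightarrow> nat) \<Rightarrow> nat \<Rightarrow> 'v hypergraph \<Rightarrow> nat" where
  "color_count_in G f j B = card ({p \<in> occurrences G. f p = j} \<inter> occurrences B)"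

definition approx :: "real \<Rightarrow> real \<Rightarrow> bool" (infix "\<approx>\<^sub>r" 50) where
  "x \<approx>\<^sub>r y \<longleftrightarrow> of_int \<lfloor>y\<rfloor> \<le> x \<and> x \<le> of_int \<lceil>y\<rceil>"

lemma finite_occurrences: "finite (occurrences G)"
proof (rule finite_subset)
  show "occurrences G \<subseteq> (SIGMA e : set_mset (edges G). {..<edge_mult G e})"
    by (auto simp: occurrences_def edge_mult_def simp flip: count_greater_zero_iff)
qed auto

lemma wf_complete_partite:
  assumes "\<And>i. i \<in> {1..d} \<Longrightarrow> finite (V i)"
  shows "wf_hypergraph (complete_partite d V)"
proof -
  have "finite (\<Pi>\<^sub>E i \<in> {1..d}. V i)"
    using assms by (intro finite_PiE) auto
  then show ?thesis
    using assms by (fastforce simp: wf_hypergraph_def complete_partite_def)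
qed

lemma wf_scale: "wf_hypergraph G \<Longrightarrow> wf_hypergraph (scale_hypergraph r G)"
  by (auto simp: wf_hypergraph_def scale_hypergraph_def simp flip: count_greater_zero_iff)

lemma wf_induced: "wf_hypergraph G \<Longrightarrow> S \<subseteq> verts G \<Longrightarrow> wf_hypergraph (induced_hypergraph G S)"
  by (auto simp: wf_hypergraph_def induced_hypergraph_def intro: finite_subset)

lemma wf_color_class: "wf_hypergraph G \<Longrightarrow> wf_hypergraph (color_class G f j)"
  using finite_occurrences[of G]
  by (auto simp: wf_hypergraph_def color_class_def occurrences_def edge_mult_def
      simp flip: count_greater_zero_iff)

end

theory Submission
  imports Defs
begin

text \<open>The edges of the required coloring are built by gradually resolving what they look like. Start
from \<open>lam n\<^sup>d\<close> featureless items, of which \<open>m\<^sub>j\<close> have color \<open>j\<close>. An edge occurrence is an item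
together with \<open>2 d\<close> labels: for each class \<open>V\<^sub>i\<close> a group number (\<open>a\<^sub>i\<close> choices), then for each
class the position of the vertex within its group (\<open>b\<^sub>i\<close> choices). The labels are assigned one
after the other, and every assignment is as even as possible simultaneously

\<^item> on the items with the same earlier labels (so that in the end every edge arises from exactly
  \<open>lam\<close> items),
\<^item> on the items of color \<open>j\<close> with the same earlier labels (this controls the multiplicities, and,
  after the \<open>d\<close> group numbers, the blocks), and
\<^item> on a coarser part of color \<open>j\<close>: all of it when a group number is assigned, the items of a given
  group of \<open>V\<^sub>i\<close> when positions in \<open>V\<^sub>i\<close> are assigned (this controls the degrees).

This is possible because each step deals with just two partitions of the items and their common
refinement: one by color (and group), one by all earlier labels. Viewing an item as an edge that
joins its two classes, the step is an edge coloring of a bipartite multigraph which is equitable at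
the vertices and balanced on parallel edges; such colorings were found by de Werra
(\<open>two_labels_equitable_split\<close>). For two colors one pairs up items inside parallel classes and inside
the two vertex classes; the union of two matchings is 2-colorable (\<open>flip_two_involutions\<close>). For \<open>k\<close>
colors one minimizes a sum of squares, since rebalancing any two colors would lower it
(\<open>equitable_split_from_halvings\<close>).

Rounding errors do not accumulate: an integer that rounds \<open>x / k\<close>, where \<open>x\<close> is an integer rounding
\<open>M / D\<close>, rounds \<open>M / (D k)\<close> (\<open>near_quotient_trans\<close>). So the iterated steps
(\<open>iterated_equitable_labelling\<close>) give all four estimates; in particular, the degree estimate is the
composition of the group step and the position step, as \<open>a\<^sub>i b\<^sub>i = n\<close>.\<close>

section \<open>Rounded quotients\<close>

text \<open>For \<open>D > 0\<close> this is \<open>\<bar>x - M / D\<bar> < 1\<close>, which for an integer \<open>x\<close> is the relation \<open>x \<approx> M / D\<close>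
cleared of floors and denominators.\<close>
definition near_quotient :: "nat \<Rightarrow> nat \<Rightarrow> nat \<Rightarrow> bool" where
  "near_quotient x M D \<longleftrightarrow> D * x < M + D \<and> M < D * x + D"

text \<open>Integrality makes this work: \<open>k z < x + k\<close> improves to \<open>k z + 1 \<le> x + k\<close>, and after
multiplication by \<open>D\<close> the gained \<open>D\<close> absorbs the error in \<open>D x < M + D\<close>.\<close>
lemma near_quotient_trans:
  assumes "near_quotient x M D" "near_quotient z x k"
  shows "near_quotient z M (D * k)"
proof -
  have "k * z + 1 \<le> x + k" "x + 1 \<le> k * z + k"
    using assms(2) by (auto simp: near_quotient_def)
  then have "D * (k * z + 1) \<le> D * (x + k)" "D * (x + 1) \<le> D * (k * z + k)"
    by (simp_all only: mult_le_mono2)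
  then show ?thesis
    using assms(1) by (simp add: near_quotient_def algebra_simps)
qed

lemma near_quotient_exact:
  assumes "near_quotient z (r * D) D"
  shows "z = r"
proof -
  have "D * z < D * (r + 1)" "D * r < D * (z + 1)"
    using assms by (auto simp: near_quotient_def algebra_simps)
  then show ?thesis by (simp only: mult_less_cancel1) simp
qed

lemma near_quotient_imp_approx:
  assumes "near_quotient x M D" "D > 0"
  shows "real x \<approx>\<^sub>r real M / real D"
proof -
  have "real (D * x) < real (M + D)" "real M < real (D * x + D)"
    using assms(1) unfolding near_quotient_def of_nat_less_iff by auto
  then have *: "real x < real M / real D + 1" "real M / real D < real x + 1"
    using assms(2) by (simp_all add: field_simps)
  have "\<lfloor>real M / real D\<rfloor> < int x + 1"
    unfolding floor_less_iff using *(2) by simp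
  moreover have "int x - 1 < \<lceil>real M / real D\<rceil>"
    unfolding less_ceiling_iff using *(1) by simp
  ultimately show ?thesis
    unfolding approx_def by linarith
qed

section \<open>Halving two partitions at once\<close>

text \<open>The non-fixed orbits of \<open>\<sigma>\<close> and of \<open>\<tau>\<close> are two matchings, and a cycle in their union alternates
between them, hence has even length. The induction contracts a \<open>\<sigma>\<close>-pair \<open>{x, y}\<close>: the
\<open>\<tau>\<close>-partners of \<open>x\<close> and \<open>y\<close> become \<open>\<tau>\<close>-partners of each other. In a flipping coloring of the
rest they differ, so \<open>x\<close> and \<open>y\<close> can be given opposite values as well.\<close>
lemma flip_two_involutions:
  fixes \<sigma> \<tau> :: "'x \<Rightarrow> 'x"
  assumes "finite X"
    and "\<And>x. x \<in> X \<Longrightarrow> \<sigma> x \<in> X \<and> \<sigma> (\<sigma> x) = x"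
    and "\<And>x. x \<in> X \<Longrightarrow> \<tau> x \<in> X \<and> \<tau> (\<tau> x) = x"
  shows "\<exists>f :: 'x \<Rightarrow> bool. \<forall>x \<in> X. (\<sigma> x \<noteq> x \<longrightarrow> f (\<sigma> x) \<noteq> f x) \<and> (\<tau> x \<noteq> x \<longrightarrow> f (\<tau> x) \<noteq> f x)"
  using assms
proof (induction "card X" arbitrary: X \<sigma> \<tau> rule: less_induct)
  case less
  have step: "\<exists>f :: 'x \<Rightarrow> bool. \<forall>x \<in> X. (\<sigma> x \<noteq> x \<longrightarrow> f (\<sigma> x) \<noteq> f x) \<and> (\<tau> x \<noteq> x \<longrightarrow> f (\<tau> x) \<noteq> f x)"
    if x: "x \<in> X" and ne: "\<sigma> x \<noteq> x"
      and S: "\<And>x. x \<in> X \<Longrightarrow> \<sigma> x \<in> X \<and> \<sigma> (\<sigma> x) = x"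
      and T: "\<And>x. x \<in> X \<Longrightarrow> \<tau> x \<in> X \<and> \<tau> (\<tau> x) = x"
    for x and \<sigma> \<tau> :: "'x \<Rightarrow> 'x"
  proof -
    define y where "y = \<sigma> x"
    have y: "y \<in> X" "y \<noteq> x" "\<sigma> y = x" using x ne S by (auto simp: y_def)
    define Z where "Z = X - {x, y}"
    \<comment> \<open>The partner of \<open>z\<close> after contracting \<open>{x, y}\<close>; it is \<open>z\<close> itself when the path ends there.\<close>
    define \<tau>' where "\<tau>' z = (if \<tau> z = x then (if \<tau> y = y then z else \<tau> y)
        else if \<tau> z = y then (if \<tau> x = x then z else \<tau> x) else \<tau> z)" for z
    have fin: "finite Z" using less.prems(1) by (simp add: Z_def)
    have lt: "card Z < card X"
      unfolding Z_def using x less.prems(1) by (intro psubset_card_mono) auto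
    have S': "\<sigma> z \<in> Z \<and> \<sigma> (\<sigma> z) = z" if "z \<in> Z" for z
      using that S[of z] S[of x] y_def y by (auto simp: Z_def)
    have T': "\<tau>' z \<in> Z \<and> \<tau>' (\<tau>' z) = z" if "z \<in> Z" for z
    proof -
      have "z \<in> X" "z \<noteq> x" "z \<noteq> y" using that by (auto simp: Z_def)
      then show ?thesis using T[of z] T[OF x] T[OF y(1)] y(2)
        by (auto simp: Z_def \<tau>'_def)
    qed
    from less.hyps[OF lt fin S' T'] obtain f :: "'x \<Rightarrow> bool" where
      "\<forall>z \<in> Z. (\<sigma> z \<noteq> z \<longrightarrow> f (\<sigma> z) \<noteq> f z) \<and> (\<tau>' z \<noteq> z \<longrightarrow> f (\<tau>' z) \<noteq> f z)" ..
    then have f: "(\<sigma> z \<noteq> z \<longrightarrow> f (\<sigma> z) \<noteq> f z) \<and> (\<tau>' z \<noteq> z \<longrightarrow> f (\<tau>' z) \<noteq> f z)" if "z \<in> Z" for z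
      using that by blast
    \<comment> \<open>If neither \<open>x\<close> nor \<open>y\<close> has a \<open>\<tau>\<close>-partner in \<open>Z\<close>, either value will do.\<close>
    define fx where "fx = (if \<tau> x \<in> Z then \<not> f (\<tau> x) else if \<tau> y \<in> Z then f (\<tau> y) else True)"
    define h where "h = f(x := fx, y := \<not> fx)"
    have tx: "\<tau> x \<in> Z \<or> \<tau> x = x \<or> \<tau> x = y" and ty: "\<tau> y \<in> Z \<or> \<tau> y = x \<or> \<tau> y = y"
      using T x y by (auto simp: Z_def)
    have hx: "h x = fx" and hy: "h y = (\<not> fx)" and hZ: "\<And>z. z \<in> Z \<Longrightarrow> h z = f z"
      using y by (auto simp: h_def Z_def)
    have both: "f (\<tau> y) \<noteq> f (\<tau> x)" if "\<tau> x \<in> Z" "\<tau> y \<in> Z"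
    proof -
      have "\<tau> (\<tau> x) = x" "\<tau> (\<tau> y) = y" using T x y by auto
      moreover have "\<tau> y \<noteq> y" using that by (auto simp: Z_def)
      moreover have "\<tau> y \<noteq> \<tau> x" using calculation y by metis
      ultimately show ?thesis using f[OF that(1)] by (auto simp: \<tau>'_def)
    qed
    have hty: "h (\<tau> y) \<noteq> h y" if "\<tau> y \<noteq> y"
    proof (cases "\<tau> y \<in> Z")
      case True
      then show ?thesis using both by (auto simp: hx hy hZ fx_def)
    next
      case False
      then show ?thesis using ty that by (auto simp: hx hy)
    qed
    have htx: "h (\<tau> x) \<noteq> h x" if "\<tau> x \<noteq> x"
    proof (cases "\<tau> x \<in> Z")
      case True
      then show ?thesis by (auto simp: hx hy hZ fx_def)
    next
      case False
      then show ?thesis using tx that by (auto simp: hx hy)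
    qed
    have "(\<sigma> z \<noteq> z \<longrightarrow> h (\<sigma> z) \<noteq> h z) \<and> (\<tau> z \<noteq> z \<longrightarrow> h (\<tau> z) \<noteq> h z)" if z: "z \<in> X" for z
    proof -
      consider "z = x" | "z = y" | "z \<in> Z" using z by (auto simp: Z_def)
      then show ?thesis
      proof cases
        case 1
        have "\<sigma> x = y" by (simp add: y_def)
        then show ?thesis using htx 1 hx hy by simp
      next
        case 2
        then show ?thesis using hty hx hy y by simp
      next
        case 3
        then have zz: "z \<noteq> x" "z \<noteq> y" by (auto simp: Z_def)
        have s: "\<sigma> z \<noteq> z \<longrightarrow> h (\<sigma> z) \<noteq> h z" using f[OF 3] S'[OF 3] hZ 3 by simp
        have "h (\<tau> z) \<noteq> h z" if nz: "\<tau> z \<noteq> z"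
        proof -
          consider "\<tau> z = x" | "\<tau> z = y" | "\<tau> z \<in> Z" using T[OF z] by (auto simp: Z_def)
          then show ?thesis
          proof cases
            case 1
            then have "\<tau> x = z" using T[OF z] by simp
            then show ?thesis using htx 1 zz by auto
          next
            case 2
            then have "\<tau> y = z" using T[OF z] by simp
            then show ?thesis using hty 2 zz by auto
          next
            case tz: 3
            then have "\<tau>' z = \<tau> z" by (auto simp: Z_def \<tau>'_def)
            then show ?thesis using f[OF 3] nz hZ tz 3 by simp
          qed
        qed
        then show ?thesis using s by blast
      qed
    qed
    then show ?thesis by blast
  qed
  show ?case
  proof (cases "\<exists>x \<in> X. \<sigma> x \<noteq> x")
    case True
    then show ?thesis using step less.prems(2,3) by blast
  next
    case a: False
    show ?thesis
    proof (cases "\<exists>x \<in> X. \<tau> x \<noteq> x")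
      case True
      then obtain x where "x \<in> X" "\<tau> x \<noteq> x" by blast
      from step[OF this less.prems(3) less.prems(2)] show ?thesis by (simp add: conj_commute)
    next
      case False
      then show ?thesis using a by blast
    qed
  qed
qed

text \<open>A matching, given as an involution, inside the classes of the label \<open>l\<close>; it leaves at most one
element of each class unmatched.\<close>
definition pairing_on :: "'x set \<Rightarrow> ('x \<Rightarrow> 'c) \<Rightarrow> ('x \<Rightarrow> 'x) \<Rightarrow> bool" where
  "pairing_on X l \<sigma> \<longleftrightarrow>
     (\<forall>x \<in> X. \<sigma> x \<in> X \<and> \<sigma> (\<sigma> x) = x \<and> l (\<sigma> x) = l x) \<and>
     (\<forall>x \<in> X. \<forall>y \<in> X. l x = l y \<and> \<sigma> x = x \<and> \<sigma> y = y \<longrightarrow> x = y)"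

lemma pairing_onD:
  assumes "pairing_on X l \<sigma>" "x \<in> X"
  shows "\<sigma> x \<in> X" "\<sigma> (\<sigma> x) = x" "l (\<sigma> x) = l x"
  using assms unfolding pairing_on_def by blast+

lemma pairing_on_fixed_unique:
  assumes "pairing_on X l \<sigma>" "x \<in> X" "y \<in> X" "l x = l y" "\<sigma> x = x" "\<sigma> y = y"
  shows "x = y"
  using assms unfolding pairing_on_def by blast

lemma pairing_exists:
  assumes "finite X"
  shows "\<exists>\<sigma>. pairing_on X l \<sigma>"
  using assms
proof (induction "card X" arbitrary: X rule: less_induct)
  case less
  show ?case
  proof (cases "inj_on l X")
    case True
    then have "pairing_on X l id" by (auto simp: pairing_on_def inj_on_def)
    then show ?thesis by blast
  next
    case False
    then obtain x y where xy: "x \<in> X" "y \<in> X" "x \<noteq> y" "l x = l y" by (auto simp: inj_on_def)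
    have "card (X - {x, y}) < card X"
      using xy less.prems by (intro psubset_card_mono) auto
    then obtain \<sigma> where "pairing_on (X - {x, y}) l \<sigma>"
      using less by (metis finite_Diff)
    then have s: "\<And>z. z \<in> X - {x, y} \<Longrightarrow> \<sigma> z \<in> X - {x, y} \<and> \<sigma> (\<sigma> z) = z \<and> l (\<sigma> z) = l z"
      and u: "\<And>z z'. z \<in> X - {x, y} \<Longrightarrow> z' \<in> X - {x, y} \<Longrightarrow> l z = l z' \<Longrightarrow> \<sigma> z = z \<Longrightarrow> \<sigma> z' = z' \<Longrightarrow> z = z'"
      using pairing_onD[of _ l \<sigma>] pairing_on_fixed_unique[of _ l \<sigma>] by blast+
    have "pairing_on X l (\<sigma>(x := y, y := x))"
      unfolding pairing_on_def
    proof (intro conjI ballI impI)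
      fix z assume "z \<in> X"
      then consider "z = x" | "z = y" | "z \<in> X - {x, y}" by blast
      then have "(\<sigma>(x := y, y := x)) z \<in> X \<and> (\<sigma>(x := y, y := x)) ((\<sigma>(x := y, y := x)) z) = z \<and>
          l ((\<sigma>(x := y, y := x)) z) = l z"
        using s[of z] xy by cases auto
      then show "(\<sigma>(x := y, y := x)) z \<in> X" "(\<sigma>(x := y, y := x)) ((\<sigma>(x := y, y := x)) z) = z"
          "l ((\<sigma>(x := y, y := x)) z) = l z"
        by blast+
    next
      fix z z' assume "z \<in> X" "z' \<in> X"
        "l z = l z' \<and> (\<sigma>(x := y, y := x)) z = z \<and> (\<sigma>(x := y, y := x)) z' = z'"
      then show "z = z'" using u[of z z'] xy by (auto split: if_splits)
    qed
    then show ?thesis by blast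
  qed
qed

text \<open>The elements that \<open>\<rho>\<close> leaves unmatched are paired within the coarser classes of \<open>p\<close>. A coloring
that flips along \<open>\<sigma>\<close> then also flips along \<open>\<rho>\<close>, so that one matching serves both the classes of
\<open>p\<close> and their refinement by \<open>q\<close>.\<close>
lemma nested_pairing:
  assumes "finite X" and fine: "pairing_on X (\<lambda>x. (p x, q x)) \<rho>"
  shows "\<exists>\<sigma>. pairing_on X p \<sigma> \<and> (\<forall>x \<in> X. \<rho> x \<noteq> x \<longrightarrow> \<sigma> x = \<rho> x)"
proof -
  define F where "F = {x \<in> X. \<rho> x = x}"
  obtain \<omega> where \<omega>: "pairing_on F p \<omega>"
    using pairing_exists[of F p] assms(1) by (auto simp: F_def)
  define \<sigma> where "\<sigma> x = (if x \<in> F then \<omega> x else \<rho> x)" for x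
  have a: "\<rho> x \<in> X" "\<rho> (\<rho> x) = x" "p (\<rho> x) = p x" if "x \<in> X" for x
    using pairing_onD[OF fine that] by auto
  have b: "\<omega> x \<in> F" "\<omega> (\<omega> x) = x" "p (\<omega> x) = p x" if "x \<in> F" for x
    using pairing_onD[OF \<omega> that] by auto
  have c: "\<rho> x \<notin> F" if "x \<in> X" "x \<notin> F" for x
    using that a(2)[of x] by (auto simp: F_def)
  have FX: "F \<subseteq> X" by (auto simp: F_def)
  have "pairing_on X p \<sigma>"
    unfolding pairing_on_def
  proof (intro conjI ballI impI)
    fix x assume x: "x \<in> X"
    show "\<sigma> x \<in> X" "\<sigma> (\<sigma> x) = x" "p (\<sigma> x) = p x"
      using x a[of x] b[of x] c[of x] FX by (auto simp: \<sigma>_def)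
  next
    fix x y assume xy: "x \<in> X" "y \<in> X" "p x = p y \<and> \<sigma> x = x \<and> \<sigma> y = y"
    then have F: "x \<in> F" "y \<in> F" by (auto simp: \<sigma>_def F_def split: if_splits)
    then have "\<omega> x = x" "\<omega> y = y" using xy by (auto simp: \<sigma>_def)
    then show "x = y" using xy F pairing_on_fixed_unique[OF \<omega>] by blast
  qed
  moreover have "\<forall>x \<in> X. \<rho> x \<noteq> x \<longrightarrow> \<sigma> x = \<rho> x" by (simp add: \<sigma>_def F_def)
  ultimately show ?thesis by blast
qed

text \<open>Matched elements cancel, and at most one element of the class is unmatched.\<close>
lemma pairing_balances:
  assumes "finite X" and pr: "pairing_on X l \<sigma>"
    and flip: "\<And>x. x \<in> X \<Longrightarrow> \<sigma> x \<noteq> x \<Longrightarrow> f (\<sigma> x) = (\<not> f x)"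
  shows "card {x \<in> X. l x = c \<and> f x} \<le> card {x \<in> X. l x = c \<and> \<not> f x} + 1"
    and "card {x \<in> X. l x = c \<and> \<not> f x} \<le> card {x \<in> X. l x = c \<and> f x} + 1"
proof -
  have gen: "card {x \<in> X. l x = c \<and> g x} \<le> card {x \<in> X. l x = c \<and> \<not> g x} + 1"
    if flip: "\<And>x. x \<in> X \<Longrightarrow> \<sigma> x \<noteq> x \<Longrightarrow> g (\<sigma> x) = (\<not> g x)" for g
  proof -
    note a = pairing_onD[OF pr] and u = pairing_on_fixed_unique[OF pr]
    let ?A = "{x \<in> X. l x = c \<and> g x \<and> \<sigma> x \<noteq> x}" and ?F = "{x \<in> X. l x = c \<and> \<sigma> x = x}"
    have "card ?A \<le> card {x \<in> X. l x = c \<and> \<not> g x}"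
    proof (rule card_inj_on_le)
      show "inj_on \<sigma> ?A" by (rule inj_on_inverseI[of _ \<sigma>]) (simp add: a(2))
      show "\<sigma> ` ?A \<subseteq> {x \<in> X. l x = c \<and> \<not> g x}" using a(1,3) flip by auto
    qed (use assms(1) in simp)
    moreover have "card ?F \<le> 1"
      using u assms(1) by (simp add: card_le_Suc0_iff_eq)
    moreover have "card {x \<in> X. l x = c \<and> g x} \<le> card (?A \<union> ?F)"
      using assms(1) by (intro card_mono) auto
    ultimately show ?thesis using card_Un_le[of ?A ?F] by linarith
  qed
  show "card {x \<in> X. l x = c \<and> f x} \<le> card {x \<in> X. l x = c \<and> \<not> f x} + 1"
    by (rule gen) (rule flip)
  show "card {x \<in> X. l x = c \<and> \<not> f x} \<le> card {x \<in> X. l x = c \<and> f x} + 1"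
    using gen[of "\<lambda>x. \<not> f x"] flip by simp
qed

definition halves :: "'x set \<Rightarrow> 'x set set \<Rightarrow> ('x \<Rightarrow> bool) \<Rightarrow> bool" where
  "halves Y \<F> f \<longleftrightarrow> (\<forall>S \<in> \<F>.
     card {x \<in> S \<inter> Y. f x} \<le> card {x \<in> S \<inter> Y. \<not> f x} + 1 \<and>
     card {x \<in> S \<inter> Y. \<not> f x} \<le> card {x \<in> S \<inter> Y. f x} + 1)"

definition label_classes :: "'x set \<Rightarrow> ('x \<Rightarrow> 'c) \<Rightarrow> 'x set set" where
  "label_classes X l = (\<lambda>c. {x \<in> X. l x = c}) ` (l ` X)"

text \<open>Three families have to be halved, but two matchings suffice, as the one for \<open>p\<close> is chosen to extend
the one for the common refinement.\<close>
lemma two_labels_halving: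
  fixes p :: "'x \<Rightarrow> 'p" and q :: "'x \<Rightarrow> 'q"
  assumes "finite X" "Y \<subseteq> X"
  shows "\<exists>f. halves Y (label_classes X p \<union> label_classes X q \<union> label_classes X (\<lambda>x. (p x, q x))) f"
proof -
  have fin: "finite Y" using assms finite_subset by blast
  obtain \<rho> where \<rho>: "pairing_on Y (\<lambda>x. (p x, q x)) \<rho>" using pairing_exists[OF fin] by blast
  obtain \<sigma> where \<sigma>: "pairing_on Y p \<sigma>" "\<And>x. x \<in> Y \<Longrightarrow> \<rho> x \<noteq> x \<Longrightarrow> \<sigma> x = \<rho> x"
    using nested_pairing[OF fin \<rho>] by blast
  obtain \<tau> where \<tau>: "pairing_on Y q \<tau>" using pairing_exists[OF fin] by blast
  have "\<sigma> x \<in> Y \<and> \<sigma> (\<sigma> x) = x" "\<tau> x \<in> Y \<and> \<tau> (\<tau> x) = x" if "x \<in> Y" for x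
    using pairing_onD[OF \<sigma>(1) that] pairing_onD[OF \<tau> that] by simp_all
  from flip_two_involutions[of Y \<sigma> \<tau>, OF fin this] obtain f :: "'x \<Rightarrow> bool" where
    F: "\<forall>x \<in> Y. (\<sigma> x \<noteq> x \<longrightarrow> f (\<sigma> x) \<noteq> f x) \<and> (\<tau> x \<noteq> x \<longrightarrow> f (\<tau> x) \<noteq> f x)" ..
  then have f: "\<And>x. x \<in> Y \<Longrightarrow> \<sigma> x \<noteq> x \<Longrightarrow> f (\<sigma> x) = (\<not> f x)"
      "\<And>x. x \<in> Y \<Longrightarrow> \<tau> x \<noteq> x \<Longrightarrow> f (\<tau> x) = (\<not> f x)"
    by auto
  have f\<rho>: "f (\<rho> x) = (\<not> f x)" if "x \<in> Y" "\<rho> x \<noteq> x" for x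
    using f(1)[of x] \<sigma>(2)[of x] that by simp
  have e: "{x \<in> {x \<in> X. l x = c} \<inter> Y. g x} = {x \<in> Y. l x = c \<and> g x}" for l :: "'x \<Rightarrow> 'z" and c g
    using assms(2) by auto
  note b = pairing_balances[where f = f, OF fin \<sigma>(1) f(1)] pairing_balances[where f = f, OF fin \<tau> f(2)]
    pairing_balances[where f = f, OF fin \<rho> f\<rho>]
  have "halves Y (label_classes X p \<union> label_classes X q \<union> label_classes X (\<lambda>x. (p x, q x))) f"
    unfolding halves_def label_classes_def unfolding ball_Un ball_simps e by (intro conjI ballI b)
  then show ?thesis by blast
qed

section \<open>Equitable splitting into several parts\<close>

lemma sum_squares_balance:
  fixes a b a' b' :: nat
  assumes "a + b = a' + b'" "a' \<le> b' + 1" "b' \<le> a' + 1"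
  shows "a'^2 + b'^2 \<le> a^2 + b^2" and "b + 2 \<le> a \<Longrightarrow> a'^2 + b'^2 < a^2 + b^2"
proof -
  define t e where "t = int a - int a'" and "e = int b' - int a'"
  have e: "e = -1 \<or> e = 0 \<or> e = 1" using assms by (auto simp: e_def)
  \<comment> \<open>With the sum fixed, the gain is \<open>2 t (t - e)\<close>, and no integer lies strictly between \<open>0\<close> and \<open>e\<close>.\<close>
  have eq: "(int a)^2 + (int b)^2 - ((int a')^2 + (int b')^2) = 2 * (t * (t - e))"
  proof -
    have *: "int a = int a' + t" "int b' = int a' + e" "int b = int a' + e - t"
      using assms by (auto simp: t_def e_def)
    show ?thesis
      unfolding * power2_eq_square by (simp add: algebra_simps)
  qed
  have "t * (t - e) \<ge> 0"
    using e by (cases "t \<le> -1"; cases "t = 0"; cases "t = 1") (auto intro: mult_nonpos_nonpos)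
  then have "int (a'^2 + b'^2) \<le> int (a^2 + b^2)" using eq by simp
  then show "a'^2 + b'^2 \<le> a^2 + b^2" by linarith
  assume "b + 2 \<le> a"
  then have "t \<ge> 1" "t - e \<ge> 1" using e assms by (auto simp: t_def e_def)
  then have "t * (t - e) > 0" by simp
  then have "int (a'^2 + b'^2) < int (a^2 + b^2)" using eq by simp
  then show "a'^2 + b'^2 < a^2 + b^2" by linarith
qed

text \<open>Take a labelling \<open>g\<close> that minimizes the sum, over all sets of the family, of the squares of the
sizes of their parts. If some set of the
family had parts \<open>u\<close> and \<open>v\<close> whose sizes differ by at least two, then an even redistribution of the
elements labelled \<open>u\<close> or \<open>v\<close> would lower the sum for this set and not raise it for any other.\<close>
lemma equitable_split_from_halvings:
  fixes \<F> :: "'x set set" and k :: nat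
  assumes "finite X" "finite \<F>" "k > 0" and sub: "\<And>S. S \<in> \<F> \<Longrightarrow> S \<subseteq> X"
    and halving: "\<And>Y. Y \<subseteq> X \<Longrightarrow> \<exists>f. halves Y \<F> f"
  shows "\<exists>g. (\<forall>x \<in> X. g x < k) \<and>
    (\<forall>S \<in> \<F>. \<forall>v < k. near_quotient (card {x \<in> S. g x = v}) (card S) k)"
proof -
  define \<Phi> where "\<Phi> g = (\<Sum>S \<in> \<F>. \<Sum>v < k. (card {x \<in> S. g x = v})^2)" for g :: "'x \<Rightarrow> nat"
  obtain g where g: "\<forall>x \<in> X. g x < k"
    and least: "\<And>h. \<forall>x \<in> X. h x < k \<Longrightarrow> \<Phi> g \<le> \<Phi> h"
    using ex_has_least_nat[of "\<lambda>g. \<forall>x \<in> X. g x < k" "\<lambda>_. 0" \<Phi>] \<open>k > 0\<close> by auto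
  have finS: "finite S" if "S \<in> \<F>" for S using sub[OF that] assms(1) finite_subset by blast
  have bal: "card {x \<in> S. g x = u} \<le> card {x \<in> S. g x = v} + 1"
    if S: "S \<in> \<F>" and uv: "u < k" "v < k" for S u v
  proof (rule ccontr)
    assume neg: "\<not> ?thesis"
    then have ne: "u \<noteq> v" by auto
    define Y where "Y = {x \<in> X. g x = u \<or> g x = v}"
    have YX: "Y \<subseteq> X" by (auto simp: Y_def)
    obtain f where f: "halves Y \<F> f" using halving[OF YX] by blast
    define h where "h x = (if x \<in> Y then if f x then u else v else g x)" for x
    have h: "\<forall>x \<in> X. h x < k" using g uv by (auto simp: h_def)
    have split: "(\<Sum>w < k. \<phi> w) = \<phi> u + \<phi> v + (\<Sum>w \<in> {..<k} - {u, v}. \<phi> w)" for \<phi> :: "nat \<Rightarrow> nat"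
      using uv ne by (subst sum.subset_diff[of "{u, v}"]) auto
    have rest: "{x \<in> R. h x = w} = {x \<in> R. g x = w}" if "R \<in> \<F>" "w \<in> {..<k} - {u, v}" for R w
      using that sub[of R] by (auto simp: h_def Y_def)
    have hu: "{x \<in> R. h x = u} = {x \<in> R \<inter> Y. f x}" and hv: "{x \<in> R. h x = v} = {x \<in> R \<inter> Y. \<not> f x}"
      if "R \<in> \<F>" for R
      using sub[OF that] ne by (auto simp: h_def Y_def split: if_splits)
    have tot: "card {x \<in> R. g x = u} + card {x \<in> R. g x = v} = card {x \<in> R. h x = u} + card {x \<in> R. h x = v}"
      if "R \<in> \<F>" for R
    proof -
      have "{x \<in> R. g x = u} \<union> {x \<in> R. g x = v} = {x \<in> R. h x = u} \<union> {x \<in> R. h x = v}"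
        using sub[OF that] ne by (auto simp: h_def Y_def split: if_splits)
      moreover have "card {x \<in> R. g x = u} + card {x \<in> R. g x = v} = card ({x \<in> R. g x = u} \<union> {x \<in> R. g x = v})"
        using ne finS[OF that] by (intro card_Un_disjoint[symmetric]) auto
      moreover have "card {x \<in> R. h x = u} + card {x \<in> R. h x = v} = card ({x \<in> R. h x = u} \<union> {x \<in> R. h x = v})"
        using ne finS[OF that] by (intro card_Un_disjoint[symmetric]) auto
      ultimately show ?thesis by simp
    qed
    have hh: "card {x \<in> R. h x = u} \<le> card {x \<in> R. h x = v} + 1"
        "card {x \<in> R. h x = v} \<le> card {x \<in> R. h x = u} + 1" if "R \<in> \<F>" for R
      using f that unfolding halves_def hu[OF that] hv[OF that] by auto
    have "\<Phi> h < \<Phi> g"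
      unfolding \<Phi>_def
    proof (rule sum_strict_mono_ex1[OF assms(2)])
      show "\<forall>R \<in> \<F>. (\<Sum>w < k. (card {x \<in> R. h x = w})^2) \<le> (\<Sum>w < k. (card {x \<in> R. g x = w})^2)"
        using sum_squares_balance(1)[OF tot hh] by (simp add: split rest)
      show "\<exists>R \<in> \<F>. (\<Sum>w < k. (card {x \<in> R. h x = w})^2) < (\<Sum>w < k. (card {x \<in> R. g x = w})^2)"
        using sum_squares_balance(2)[OF tot[OF S] hh[OF S]] neg
        by (intro bexI[OF _ S]) (simp add: split rest S)
    qed
    then show False using least[OF h] by simp
  qed
  have "near_quotient (card {x \<in> S. g x = v}) (card S) k" if S: "S \<in> \<F>" and v: "v < k" for S v
  proof -
    let ?N = "\<lambda>u. card {x \<in> S. g x = u}"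
    have "card S = card (\<Union>u \<in> {..<k}. {x \<in> S. g x = u})"
      using g sub[OF S] by (intro arg_cong[of _ _ card]) auto
    also have "\<dots> = (\<Sum>u < k. ?N u)"
      using finS[OF S] by (intro card_UN_disjoint) auto
    also have "\<dots> = ?N v + (\<Sum>u \<in> {..<k} - {v}. ?N u)"
      using v by (simp add: sum.remove)
    finally have c: "card S = ?N v + (\<Sum>u \<in> {..<k} - {v}. ?N u)" .
    have k1: "card ({..<k} - {v}) = k - 1" using v by simp
    have "(\<Sum>u \<in> {..<k} - {v}. ?N u) \<le> (\<Sum>u \<in> {..<k} - {v}. ?N v + 1)"
      using bal[OF S _ v] by (intro sum_mono) auto
    moreover have "(\<Sum>u \<in> {..<k} - {v}. ?N v) \<le> (\<Sum>u \<in> {..<k} - {v}. ?N u + 1)"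
      using bal[OF S v] by (intro sum_mono) auto
    ultimately have "card S \<le> ?N v + (k - 1) * (?N v + 1)"
        "?N v + (k - 1) * ?N v \<le> card S + (k - 1)"
      using c k1 by (simp_all add: sum_Suc)
    moreover obtain k' where "k = Suc k'" using v by (cases k) auto
    ultimately show ?thesis by (auto simp: near_quotient_def)
  qed
  then show ?thesis using g by blast
qed

text \<open>With \<open>p\<close> and \<open>q\<close> as the two endpoints of an edge \<open>x\<close>, this is de Werra's theorem that every finite
bipartite multigraph has an edge coloring with \<open>k\<close> colors that is equitable at each vertex and on
each bundle of parallel edges.\<close>
lemma two_labels_equitable_split:
  fixes p :: "'x \<Rightarrow> 'p" and q :: "'x \<Rightarrow> 'q" and k :: nat
  assumes "finite X" "k > 0"
  shows "\<exists>g. (\<forall>x \<in> X. g x < k) \<and> (\<forall>v < k. \<forall>c c'.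
      near_quotient (card {x \<in> X. p x = c \<and> g x = v}) (card {x \<in> X. p x = c}) k \<and>
      near_quotient (card {x \<in> X. q x = c' \<and> g x = v}) (card {x \<in> X. q x = c'}) k \<and>
      near_quotient (card {x \<in> X. p x = c \<and> q x = c' \<and> g x = v}) (card {x \<in> X. p x = c \<and> q x = c'}) k)"
proof -
  let ?F = "label_classes X p \<union> label_classes X q \<union> label_classes X (\<lambda>x. (p x, q x))"
  have "\<exists>g. (\<forall>x \<in> X. g x < k) \<and>
    (\<forall>S \<in> ?F. \<forall>v < k. near_quotient (card {x \<in> S. g x = v}) (card S) k)"
    using assms two_labels_halving[OF assms(1)]
    by (intro equitable_split_from_halvings) (auto simp: label_classes_def)
  then obtain g where g: "\<forall>x \<in> X. g x < k"
    and near: "\<And>S v. S \<in> ?F \<Longrightarrow> v < k \<Longrightarrow> near_quotient (card {x \<in> S. g x = v}) (card S) k"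
    by blast
  have *: "near_quotient (card {x \<in> X. l x = c \<and> g x = v}) (card {x \<in> X. l x = c}) k"
    if "label_classes X l \<subseteq> ?F" "v < k" for l :: "'x \<Rightarrow> 'z" and c v
  proof (cases "c \<in> l ` X")
    case True
    then have "{x \<in> X. l x = c} \<in> ?F" using that(1) by (auto simp: label_classes_def)
    from near[OF this that(2)] show ?thesis by (simp add: conj_assoc)
  next
    case False
    then have e: "{x \<in> X. l x = c} = {}" "{x \<in> X. l x = c \<and> g x = v} = {}" by auto
    show ?thesis unfolding e using assms(2) by (simp add: near_quotient_def)
  qed
  have "near_quotient (card {x \<in> X. p x = c \<and> q x = c' \<and> g x = v}) (card {x \<in> X. p x = c \<and> q x = c'}) k"
    if "v < k" for c c' v
    using *[of "\<lambda>x. (p x, q x)" v "(c, c')"] that by (simp add: conj_assoc)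
  then show ?thesis using g *[of p] *[of q] by blast
qed

section \<open>Successive equitable labellings\<close>

text \<open>The items \<open>x\<close> of \<open>X\<close> carry the labels \<open>g x t < \<kappa> t\<close> for \<open>t < T\<close>, assigned in the order of \<open>t\<close>. The
set \<open>P t\<close> selects the earlier labels that, with the color, determine the coarse classes on which the
\<open>t\<close>-th label is spread evenly. The second condition compares sizes before and after a single step. The
last two describe the fine classes, cut out by all of the first \<open>t\<close> labels, and compare with the
sizes before any label was assigned.\<close>
definition equitable_labelling ::
  "'x set \<Rightarrow> ('x \<Rightarrow> 'c) \<Rightarrow> (nat \<Rightarrow> nat) \<Rightarrow> (nat \<Rightarrow> nat set) \<Rightarrow> nat \<Rightarrow> ('x \<Rightarrow> nat \<Rightarrow> nat) \<Rightarrow> bool" where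
  "equitable_labelling X col \<kappa> P T g \<longleftrightarrow>
    (\<forall>x \<in> X. \<forall>t < T. g x t < \<kappa> t) \<and>
    (\<forall>t < T. \<forall>j y. y t < \<kappa> t \<longrightarrow>
       near_quotient (card {x \<in> X. col x = j \<and> (\<forall>s \<in> P t. g x s = y s) \<and> g x t = y t})
         (card {x \<in> X. col x = j \<and> (\<forall>s \<in> P t. g x s = y s)}) (\<kappa> t)) \<and>
    (\<forall>t \<le> T. \<forall>y. (\<forall>s < t. y s < \<kappa> s) \<longrightarrow>
       near_quotient (card {x \<in> X. \<forall>s < t. g x s = y s}) (card X) (\<Prod>s < t. \<kappa> s)) \<and>
    (\<forall>t \<le> T. \<forall>y j. (\<forall>s < t. y s < \<kappa> s) \<longrightarrow>
       near_quotient (card {x \<in> X. col x = j \<and> (\<forall>s < t. g x s = y s)})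
         (card {x \<in> X. col x = j}) (\<Prod>s < t. \<kappa> s))"

text \<open>Each step splits with \<open>p\<close> the color and the labels selected by \<open>P t\<close>, and \<open>q\<close> all earlier labels. As
\<open>P t\<close> consists of earlier labels, fixing \<open>q\<close> and the color also fixes \<open>p\<close>, and so the common classes
of \<open>p\<close> and \<open>q\<close> are the fine classes within a color.\<close>
lemma iterated_equitable_labelling:
  fixes col :: "'x \<Rightarrow> 'c" and \<kappa> :: "nat \<Rightarrow> nat" and P :: "nat \<Rightarrow> nat set"
  assumes "finite X" "\<And>t. t < T \<Longrightarrow> \<kappa> t > 0" "\<And>t. t < T \<Longrightarrow> P t \<subseteq> {..<t}"
  shows "\<exists>g. equitable_labelling X col \<kappa> P T g"
  using assms(2,3)
proof (induction T)
  case 0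
  show ?case by (auto simp: equitable_labelling_def near_quotient_def)
next
  case (Suc T)
  obtain g where g: "equitable_labelling X col \<kappa> P T g"
    using Suc.IH Suc.prems by (metis less_SucI)
  have g1: "\<And>x t. x \<in> X \<Longrightarrow> t < T \<Longrightarrow> g x t < \<kappa> t"
    using g unfolding equitable_labelling_def by blast
  have g2: "\<And>t j y. t < T \<Longrightarrow> y t < \<kappa> t \<Longrightarrow>
       near_quotient (card {x \<in> X. col x = j \<and> (\<forall>s \<in> P t. g x s = y s) \<and> g x t = y t})
         (card {x \<in> X. col x = j \<and> (\<forall>s \<in> P t. g x s = y s)}) (\<kappa> t)"
    using g unfolding equitable_labelling_def by blast
  have g3: "\<And>t y. t \<le> T \<Longrightarrow> \<forall>s < t. y s < \<kappa> s \<Longrightarrow>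
       near_quotient (card {x \<in> X. \<forall>s < t. g x s = y s}) (card X) (\<Prod>s < t. \<kappa> s)"
    using g unfolding equitable_labelling_def by blast
  have g4: "\<And>t y j. t \<le> T \<Longrightarrow> \<forall>s < t. y s < \<kappa> s \<Longrightarrow>
       near_quotient (card {x \<in> X. col x = j \<and> (\<forall>s < t. g x s = y s)})
         (card {x \<in> X. col x = j}) (\<Prod>s < t. \<kappa> s)"
    using g unfolding equitable_labelling_def by blast
  have kT: "\<kappa> T > 0" and PT: "P T \<subseteq> {..<T}" using Suc.prems by auto
  obtain w where w1: "\<And>x. x \<in> X \<Longrightarrow> w x < \<kappa> T"
    and wp: "\<And>v c. v < \<kappa> T \<Longrightarrow> near_quotient
      (card {x \<in> X. (col x, restrict (g x) (P T)) = c \<and> w x = v})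
      (card {x \<in> X. (col x, restrict (g x) (P T)) = c}) (\<kappa> T)"
    and wq: "\<And>v c'. v < \<kappa> T \<Longrightarrow> near_quotient
      (card {x \<in> X. restrict (g x) {..<T} = c' \<and> w x = v})
      (card {x \<in> X. restrict (g x) {..<T} = c'}) (\<kappa> T)"
    and wpq: "\<And>v c c'. v < \<kappa> T \<Longrightarrow> near_quotient
      (card {x \<in> X. (col x, restrict (g x) (P T)) = c \<and> restrict (g x) {..<T} = c' \<and> w x = v})
      (card {x \<in> X. (col x, restrict (g x) (P T)) = c \<and> restrict (g x) {..<T} = c'}) (\<kappa> T)"
    using two_labels_equitable_split[OF assms(1) kT, of "\<lambda>x. (col x, restrict (g x) (P T))"
        "\<lambda>x. restrict (g x) {..<T}"] by blast
  have restr: "restrict u A = restrict v A \<longleftrightarrow> (\<forall>s \<in> A. u s = v s)" for u v :: "nat \<Rightarrow> nat" and A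
    by (auto simp: restrict_def fun_eq_iff)
  define h where "h x = (g x)(T := w x)" for x
  have hT: "h x T = w x" and hs: "s < T \<Longrightarrow> h x s = g x s" for x s
    by (auto simp: h_def)
  have hP: "(\<forall>s \<in> P t. h x s = y s) \<longleftrightarrow> (\<forall>s \<in> P t. g x s = y s)" if "t \<le> T" for t x y
  proof -
    have "P t \<subseteq> {..<T}" using Suc.prems(2)[of t] that by fastforce
    then show ?thesis using hs by (metis lessThan_iff subsetD)
  qed
  have hpre: "(\<forall>s < t. h x s = y s) \<longleftrightarrow> (\<forall>s < t. g x s = y s)" if "t \<le> T" for t x y
    using hs that by (metis order_less_le_trans)
  have hSuc: "(\<forall>s < Suc T. h x s = y s) \<longleftrightarrow> (\<forall>s < T. g x s = y s) \<and> w x = y T" for x y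
    using hT hs by (metis less_Suc_eq)
  have "equitable_labelling X col \<kappa> P (Suc T) h"
    unfolding equitable_labelling_def
  proof (intro conjI allI impI ballI)
    fix x t assume "x \<in> X" "t < Suc T"
    then show "h x t < \<kappa> t" using g1 w1 hT hs by (cases "t = T") auto
  next
    fix t j y assume t: "t < Suc T" and y: "y t < \<kappa> t"
    show "near_quotient (card {x \<in> X. col x = j \<and> (\<forall>s \<in> P t. h x s = y s) \<and> h x t = y t})
         (card {x \<in> X. col x = j \<and> (\<forall>s \<in> P t. h x s = y s)}) (\<kappa> t)"
    proof (cases "t = T")
      case True
      have "near_quotient (card {x \<in> X. col x = j \<and> (\<forall>s \<in> P T. g x s = y s) \<and> w x = y T})
         (card {x \<in> X. col x = j \<and> (\<forall>s \<in> P T. g x s = y s)}) (\<kappa> T)"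
        using wp[of "y T" "(j, restrict y (P T))"] y True by (simp add: restr conj_assoc)
      then show ?thesis using True by (simp add: hP hT)
    next
      case False
      then show ?thesis using t g2[of t y j] y by (simp add: hP hs)
    qed
  next
    fix t y assume t: "t \<le> Suc T" and y: "\<forall>s < t. y s < \<kappa> s"
    show "near_quotient (card {x \<in> X. \<forall>s < t. h x s = y s}) (card X) (\<Prod>s < t. \<kappa> s)"
    proof (cases "t = Suc T")
      case True
      have "near_quotient (card {x \<in> X. (\<forall>s < T. g x s = y s) \<and> w x = y T})
         (card {x \<in> X. \<forall>s < T. g x s = y s}) (\<kappa> T)"
        using wq[of "y T" "restrict y {..<T}"] y True by (simp add: restr Ball_def)
      from near_quotient_trans[OF g3[of T y] this] show ?thesis
        using y True by (simp only: hSuc prod.lessThan_Suc) simp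
    next
      case False
      then show ?thesis using t g3[of t y] y by (simp add: hpre)
    qed
  next
    fix t y j assume t: "t \<le> Suc T" and y: "\<forall>s < t. y s < \<kappa> s"
    show "near_quotient (card {x \<in> X. col x = j \<and> (\<forall>s < t. h x s = y s)})
              (card {x \<in> X. col x = j}) (\<Prod>s < t. \<kappa> s)"
    proof (cases "t = Suc T")
      case True
      have im: "(\<forall>s \<in> P T. g x s = y s)" if "\<forall>s < T. g x s = y s" for x using that PT by auto
      have e: "((col x, restrict (g x) (P T)) = (j, restrict y (P T)) \<and> restrict (g x) {..<T} = restrict y {..<T})
         \<longleftrightarrow> (col x = j \<and> (\<forall>s < T. g x s = y s))" for x
        using im[of x] by (auto simp: restr)
      have "near_quotient (card {x \<in> X. col x = j \<and> (\<forall>s < T. g x s = y s) \<and> w x = y T})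
         (card {x \<in> X. col x = j \<and> (\<forall>s < T. g x s = y s)}) (\<kappa> T)"
        using wpq[of "y T" "(j, restrict y (P T))" "restrict y {..<T}"] y True
        unfolding conj_assoc[symmetric] e by simp
      from near_quotient_trans[OF g4[of T y] this] show ?thesis
        using y True by (simp only: hSuc prod.lessThan_Suc) simp
    next
      case False
      then show ?thesis using t g4[of t y j] y by (simp add: hpre)
    qed
  qed
  then show ?case by blast
qed

section \<open>Counting in colored hypergraphs\<close>

lemma card_items_of_color:
  assumes "j \<in> {1..k}"
  shows "card {x \<in> Sigma {1..k} (\<lambda>j. {..<m j}). fst x = j} = m j"
proof -
  have "{x \<in> Sigma {1..k} (\<lambda>j. {..<m j}). fst x = j} = Pair j ` {..<m j}"
    using assms by auto
  then show ?thesis by (simp add: card_image inj_on_def)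
qed

text \<open>Numbering the items above each edge identifies items with edge occurrences, and the coloring of the
items is transported along this bijection. The arbitrary predicate \<open>Q\<close> makes one statement serve edge
numbers, degrees, blocks and multiplicities.\<close>
lemma coloring_from_items:
  fixes G :: "'v hypergraph" and \<phi> :: "'x \<Rightarrow> 'v set" and col :: "'x \<Rightarrow> nat"
  assumes "finite X" and fibre: "\<And>e. card {x \<in> X. \<phi> x = e} = edge_mult G e"
  shows "\<exists>f. (\<forall>p \<in> occurrences G. f p \<in> col ` X) \<and>
    (\<forall>j Q. card {p \<in> occurrences G. f p = j \<and> Q (fst p)} = card {x \<in> X. col x = j \<and> Q (\<phi> x)})"
proof -
  have "\<forall>e. \<exists>h. bij_betw h {..<edge_mult G e} {x \<in> X. \<phi> x = e}"
    using assms(1) fibre by (intro allI finite_same_card_bij) auto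
  then obtain h where h: "\<And>e. bij_betw (h e) {..<edge_mult G e} {x \<in> X. \<phi> x = e}"
    by metis
  define H where "H p = h (fst p) (snd p)" for p
  have hX: "h e c \<in> X \<and> \<phi> (h e c) = e" if "c < edge_mult G e" for e c
    using bij_betwE[OF h[of e]] that by auto
  have H: "H p \<in> X" "\<phi> (H p) = fst p" if "p \<in> occurrences G" for p
    using that hX by (auto simp: H_def occurrences_def)
  have inj: "inj_on H (occurrences G)"
  proof (rule inj_onI)
    fix p p' assume p: "p \<in> occurrences G" "p' \<in> occurrences G" "H p = H p'"
    then have e: "fst p = fst p'" using H(2) by metis
    then have "snd p = snd p'"
      using p h[of "fst p"] by (auto simp: H_def occurrences_def bij_betw_def inj_on_def)
    with e show "p = p'" by (simp add: prod_eq_iff)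
  qed
  have surj: "\<exists>p \<in> occurrences G. H p = x" if "x \<in> X" for x
  proof -
    have "x \<in> h (\<phi> x) ` {..<edge_mult G (\<phi> x)}"
      using that bij_betw_imp_surj_on[OF h[of "\<phi> x"]] by auto
    then obtain c where "c < edge_mult G (\<phi> x)" "h (\<phi> x) c = x" by auto
    then show ?thesis by (intro bexI[of _ "(\<phi> x, c)"]) (auto simp: H_def occurrences_def)
  qed
  have "card {p \<in> occurrences G. col (H p) = j \<and> Q (fst p)} = card {x \<in> X. col x = j \<and> Q (\<phi> x)}" for j Q
  proof (rule bij_betw_same_card[of H])
    show "bij_betw H {p \<in> occurrences G. col (H p) = j \<and> Q (fst p)} {x \<in> X. col x = j \<and> Q (\<phi> x)}"
      unfolding bij_betw_def
    proof
      show "inj_on H {p \<in> occurrences G. col (H p) = j \<and> Q (fst p)}"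
        using inj by (rule inj_on_subset) auto
      show "H ` {p \<in> occurrences G. col (H p) = j \<and> Q (fst p)} = {x \<in> X. col x = j \<and> Q (\<phi> x)}"
      proof
        show "H ` {p \<in> occurrences G. col (H p) = j \<and> Q (fst p)} \<subseteq> {x \<in> X. col x = j \<and> Q (\<phi> x)}"
          using H by auto
        show "{x \<in> X. col x = j \<and> Q (\<phi> x)} \<subseteq> H ` {p \<in> occurrences G. col (H p) = j \<and> Q (fst p)}"
        proof
          fix x assume x: "x \<in> {x \<in> X. col x = j \<and> Q (\<phi> x)}"
          then obtain p where "p \<in> occurrences G" "H p = x" using surj by blast
          then show "x \<in> H ` {p \<in> occurrences G. col (H p) = j \<and> Q (fst p)}"
            using x H(2)[of p] by auto
        qed
      qed
    qed
  qed
  then show ?thesis using H by (intro exI[of _ "col \<circ> H"]) auto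
qed

lemma size_filter_color_class:
  "size {#e \<in># edges (color_class G f j). Q e#} = card {p \<in> occurrences G. f p = j \<and> Q (fst p)}"
  using finite_occurrences[of G]
  by (simp add: color_class_def filter_mset_image_mset conj_assoc)

lemma num_edges_color_class:
  "num_edges (color_class G f j) = card {p \<in> occurrences G. f p = j}"
  using size_filter_color_class[of "\<lambda>_. True" G f j] by (simp add: num_edges_def)

lemma vertex_degree_color_class:
  "vertex_degree (color_class G f j) v = card {p \<in> occurrences G. f p = j \<and> v \<in> fst p}"
  by (simp add: vertex_degree_def size_filter_color_class)

lemma edge_mult_color_class:
  "edge_mult (color_class G f j) e = card {p \<in> occurrences G. f p = j \<and> fst p = e}"
  using size_filter_color_class[of "\<lambda>e'. e' = e" G f j]
  by (simp add: edge_mult_def filter_eq_replicate_mset)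

lemma color_count_in_induced:
  "color_count_in G f j (induced_hypergraph G S) = card {p \<in> occurrences G. f p = j \<and> fst p \<subseteq> S}"
  unfolding color_count_in_def
  by (rule arg_cong[of _ _ card])
    (auto simp: occurrences_def induced_hypergraph_def edge_mult_def split: if_splits)

section \<open>Edges of the complete partite hypergraph\<close>

lemma mem_transversal_iff:
  assumes "disjoint_family_on V I" "c \<in> (\<Pi>\<^sub>E i \<in> I. V i)" "i \<in> I" "v \<in> V i"
  shows "v \<in> c ` I \<longleftrightarrow> c i = v"
proof
  assume "v \<in> c ` I"
  then obtain i' where i': "i' \<in> I" "v = c i'" by auto
  then have "v \<in> V i \<inter> V i'" using assms(2,4) by (auto simp: PiE_iff)
  then have "i = i'" using assms(1,3) i'(1) by (auto simp: disjoint_family_on_def)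
  with i' show "c i = v" by simp
qed (use assms(3) in auto)

lemma inj_on_transversal:
  assumes "disjoint_family_on V I"
  shows "inj_on (\<lambda>c. c ` I) (\<Pi>\<^sub>E i \<in> I. V i)"
proof (rule inj_onI)
  fix c c' assume c: "c \<in> (\<Pi>\<^sub>E i \<in> I. V i)" "c' \<in> (\<Pi>\<^sub>E i \<in> I. V i)" "c ` I = c' ` I"
  show "c = c'"
  proof (rule PiE_ext[OF c(1,2)])
    fix i assume i: "i \<in> I"
    then have "c i \<in> V i" "c i \<in> c' ` I" using c by auto
    then show "c i = c' i" using mem_transversal_iff[OF assms c(2) i] by simp
  qed
qed

lemma transversal_subset_iff:
  assumes "disjoint_family_on V I" "c \<in> (\<Pi>\<^sub>E i \<in> I. V i)" "\<And>i. i \<in> I \<Longrightarrow> W i \<subseteq> V i"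
  shows "c ` I \<subseteq> (\<Union>i \<in> I. W i) \<longleftrightarrow> (\<forall>i \<in> I. c i \<in> W i)"
proof
  assume s: "c ` I \<subseteq> (\<Union>i \<in> I. W i)"
  show "\<forall>i \<in> I. c i \<in> W i"
  proof
    fix i assume i: "i \<in> I"
    then obtain i' where i': "i' \<in> I" "c i \<in> W i'" using s by auto
    then have "c i \<in> V i \<inter> V i'" using assms(2,3) i by (auto simp: PiE_iff)
    then have "i = i'" using assms(1) i i' by (auto simp: disjoint_family_on_def)
    with i' show "c i \<in> W i" by simp
  qed
qed auto

lemma edge_mult_scaled_complete_partite:
  assumes "disjoint_family_on V {1..d}" "\<And>i. i \<in> {1..d} \<Longrightarrow> finite (V i)"
  shows "edge_mult (scale_hypergraph r (complete_partite d V)) e =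
    (if e \<in> (\<lambda>c. c ` {1..d}) ` (\<Pi>\<^sub>E i \<in> {1..d}. V i) then r else 0)"
proof -
  let ?E = "(\<lambda>c. c ` {1..d}) ` (\<Pi>\<^sub>E i \<in> {1..d}. V i)"
  have fin: "finite ?E" using assms(2) by (intro finite_imageI finite_PiE) auto
  have "edges (complete_partite d V) = mset_set ?E"
    using image_mset_mset_set[OF inj_on_transversal[OF assms(1)]] by (simp add: complete_partite_def)
  then show ?thesis using fin
    by (simp add: edge_mult_def scale_hypergraph_def count_mset_set')
qed

text \<open>Addresses of the vertices of one class: \<open>\<nu> s w\<close> is the \<open>w\<close>-th vertex of group \<open>s + 1\<close>. Groups are
numbered from 1 and labels from 0, whence the successor.\<close>
lemma group_coordinates:
  fixes W :: "nat \<Rightarrow> 'v set"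
  assumes disj: "disjoint_family_on W {1..r}"
    and card: "\<And>s. s \<in> {1..r} \<Longrightarrow> finite (W s) \<and> card (W s) = q"
  shows "\<exists>\<nu>. bij_betw (\<lambda>(s, w). \<nu> s w) ({..<r} \<times> {..<q}) (\<Union>s \<in> {1..r}. W s) \<and>
    (\<forall>s < r. \<forall>w < q. \<nu> s w \<in> W (Suc s))"
proof -
  have "\<forall>s \<in> {1..r}. \<exists>h. bij_betw h {..<q} (W s)"
    using card by (auto intro!: finite_same_card_bij)
  then obtain h where h: "\<And>s. s \<in> {1..r} \<Longrightarrow> bij_betw (h s) {..<q} (W s)"
    by metis
  define \<nu> where "\<nu> s = h (Suc s)" for s
  have \<nu>: "bij_betw (\<nu> s) {..<q} (W (Suc s))" if "s < r" for s
    using h[of "Suc s"] that by (simp add: \<nu>_def)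
  have mem: "\<nu> s w \<in> W (Suc s)" if "s < r" "w < q" for s w
    using bij_betwE[OF \<nu>[OF that(1)]] that(2) by auto
  have surj: "\<exists>s < r. \<exists>w < q. \<nu> s w = v" if v: "v \<in> (\<Union>s \<in> {1..r}. W s)" for v
  proof -
    obtain s where s: "s \<in> {1..r}" "v \<in> W s" using v by auto
    then obtain s' where s': "s = Suc s'" "s' < r" by (cases s) auto
    then have "v \<in> \<nu> s' ` {..<q}" using s bij_betw_imp_surj_on[OF \<nu>[of s']] by simp
    then show ?thesis using s' by auto
  qed
  have inj: "s = s' \<and> w = w'" if "s < r" "w < q" "s' < r" "w' < q" "\<nu> s w = \<nu> s' w'" for s w s' w'
  proof -
    have "\<nu> s w \<in> W (Suc s) \<inter> W (Suc s')" using mem that by (metis IntI)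
    moreover have "Suc s \<in> {1..r}" "Suc s' \<in> {1..r}" using that by auto
    ultimately have "Suc s = Suc s'" using disj unfolding disjoint_family_on_def by blast
    then have s: "s = s'" by simp
    then have "w = w'" using bij_betw_imp_inj_on[OF \<nu>[OF that(1)]] that by (auto simp: inj_on_def)
    with s show ?thesis by simp
  qed
  have "(\<lambda>(s, w). \<nu> s w) ` ({..<r} \<times> {..<q}) = (\<Union>s \<in> {1..r}. W s)"
  proof
    have "\<nu> s w \<in> (\<Union>s \<in> {1..r}. W s)" if "s < r" "w < q" for s w
      using mem[OF that] that(1) by (intro UN_I[of "Suc s"]) auto
    then show "(\<lambda>(s, w). \<nu> s w) ` ({..<r} \<times> {..<q}) \<subseteq> (\<Union>s \<in> {1..r}. W s)" by auto
    show "(\<Union>s \<in> {1..r}. W s) \<subseteq> (\<lambda>(s, w). \<nu> s w) ` ({..<r} \<times> {..<q})"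
    proof
      fix v assume "v \<in> (\<Union>s \<in> {1..r}. W s)"
      then obtain s w where "s < r" "w < q" "\<nu> s w = v" using surj by blast
      then show "v \<in> (\<lambda>(s, w). \<nu> s w) ` ({..<r} \<times> {..<q})"
        by (intro image_eqI[of _ _ "(s, w)"]) auto
    qed
  qed
  moreover have "inj_on (\<lambda>(s, w). \<nu> s w) ({..<r} \<times> {..<q})"
    using inj by (auto simp: inj_on_def)
  ultimately show ?thesis using mem unfolding bij_betw_def by blast
qed

section \<open>The coloring\<close>

theorem theorem2p1:
  fixes d lam k n :: nat
    and a b m :: "nat \<Rightarrow> nat"
    and V :: "nat \<Rightarrow> 'v set"
    and U :: "nat \<Rightarrow> nat \<Rightarrow> 'v set"
    and K G :: "'v hypergraph"
  assumes "d > 0" and "lam > 0" and "k > 0"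
    and "\<forall>i \<in> {1..d}. a i > 0"
    and "n = (\<Prod>i \<in> {1..d}. a i)"
    and "\<forall>i \<in> {1..d}. real (b i) = real n / real (a i)"
    and "disjoint_family_on V {1..d}"
    and "\<forall>i \<in> {1..d}. card (V i) = n"
    and "K = complete_partite d V"
    and "G = scale_hypergraph lam K"
    and "block_partition d V a b U"
    and "\<forall>j \<in> {1..k}. m j > 0"
    and "(\<Sum>j \<in> {1..k}. m j) = lam * n ^ d"
  shows "\<exists>f. is_coloring G k f \<and>
    (\<forall>j \<in> {1..k}.
       num_edges (color_class G f j) = m j \<and>
       (\<forall>v \<in> verts G. real (vertex_degree (color_class G f j) v) \<approx>\<^sub>r real (m j) / real n) \<and>
       (\<forall>B \<in> blocks G d a U. real (color_count_in G f j B) \<approx>\<^sub>r real (m j) / real n) \<and>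
       (\<forall>e \<in># edges K. real (edge_mult (color_class G f j) e) \<approx>\<^sub>r real (m j) / real (n ^ d)) \<and>
       (simple_hypergraph (color_class G f j) \<longleftrightarrow> m j \<le> n ^ d))"
proof -
  let ?I = "{1..d}"
  let ?T = "\<Pi>\<^sub>E i \<in> ?I. V i"
  let ?E = "(\<lambda>c. c ` ?I) ` ?T"
  have a_pos: "a i > 0" if "i \<in> ?I" for i using assms(4) that by blast
  have n_pos: "n > 0" unfolding assms(5) using a_pos by (auto intro: prod_pos)
  have ab: "a i * b i = n" if i: "i \<in> ?I" for i
  proof -
    have "real (a i * b i) = real n" using assms(6) i a_pos[OF i] by simp
    then show ?thesis by (simp only: of_nat_eq_iff)
  qed
  have b_pos: "b i > 0" if "i \<in> ?I" for i using ab[OF that] n_pos by (cases "b i") auto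
  have finV: "finite (V i)" if "i \<in> ?I" for i
    using assms(8) that n_pos by (intro card_ge_0_finite) auto
  have finT: "finite ?T" using finV by (intro finite_PiE) auto
  have U: "disjoint_family_on (U i) {1..a i}" "(\<Union>s \<in> {1..a i}. U i s) = V i"
      "\<And>s. s \<in> {1..a i} \<Longrightarrow> card (U i s) = b i" if "i \<in> ?I" for i
    using assms(11) that unfolding block_partition_def by auto
  have UV: "U i s \<subseteq> V i" if "i \<in> ?I" "s \<in> {1..a i}" for i s using U(2)[OF that(1)] that(2) by blast
  have finU: "finite (U i s) \<and> card (U i s) = b i" if "i \<in> ?I" "s \<in> {1..a i}" for i s
    using UV[OF that] finV[OF that(1)] U(3)[OF that] finite_subset by blast

  have "\<forall>i \<in> ?I. \<exists>\<nu>. bij_betw (\<lambda>(s, w). \<nu> s w) ({..<a i} \<times> {..<b i}) (\<Union>s \<in> {1..a i}. U i s) \<and>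
    (\<forall>s < a i. \<forall>w < b i. \<nu> s w \<in> U i (Suc s))"
    using U(1) finU by (intro ballI group_coordinates) auto
  then obtain \<nu> where
    \<nu>: "\<forall>i \<in> ?I. bij_betw (\<lambda>(s, w). \<nu> i s w) ({..<a i} \<times> {..<b i}) (\<Union>s \<in> {1..a i}. U i s) \<and>
      (\<forall>s < a i. \<forall>w < b i. \<nu> i s w \<in> U i (Suc s))"
    by (rule bchoice[THEN exE])
  have \<nu>U: "\<nu> i s w \<in> U i (Suc s)" if "i \<in> ?I" "s < a i" "w < b i" for i s w
    using bspec[OF \<nu> that(1)] that(2,3) by simp
  have \<nu>bij: "bij_betw (\<lambda>(s, w). \<nu> i s w) ({..<a i} \<times> {..<b i}) (V i)" if "i \<in> ?I" for i
    using bspec[OF \<nu> that] U(2)[OF that] by simp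
  have \<nu>surj: "\<exists>s < a i. \<exists>w < b i. \<nu> i s w = v" if "i \<in> ?I" "v \<in> V i" for i v
  proof -
    have "v \<in> (\<lambda>(s, w). \<nu> i s w) ` ({..<a i} \<times> {..<b i})"
      using bij_betw_imp_surj_on[OF \<nu>bij[OF that(1)]] that(2) by simp
    then show ?thesis by auto
  qed
  have \<nu>inj: "\<nu> i s w = \<nu> i s' w' \<longleftrightarrow> s = s' \<and> w = w'"
    if "i \<in> ?I" "s < a i" "w < b i" "s' < a i" "w' < b i" for i s w s' w'
    using inj_on_eq_iff[OF bij_betw_imp_inj_on[OF \<nu>bij[OF that(1)]], of "(s, w)" "(s', w')"] that(2-)
    by simp
  have \<nu>V: "\<nu> i s w \<in> V i" if "i \<in> ?I" "s < a i" "w < b i" for i s w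
    using \<nu>U[OF that] UV[OF that(1), of "Suc s"] that(2) by auto
  have \<nu>group: "\<nu> i s w \<in> U i s' \<longleftrightarrow> Suc s = s'"
    if "i \<in> ?I" "s < a i" "w < b i" "s' \<in> {1..a i}" for i s w s'
  proof
    assume "\<nu> i s w \<in> U i s'"
    then have "\<nu> i s w \<in> U i s' \<inter> U i (Suc s)" using \<nu>U that by blast
    moreover have "Suc s \<in> {1..a i}" using that(2) by auto
    ultimately show "Suc s = s'" using U(1)[OF that(1)] that(4) unfolding disjoint_family_on_def by blast
  qed (use \<nu>U that in blast)

  define X where "X = Sigma {1..k} (\<lambda>j. {..<m j})"
  have finX: "finite X" by (simp add: X_def)
  have cardX: "card X = lam * n ^ d" using assms(13) by (simp add: X_def)
  \<comment> \<open>Labels \<open>t < d\<close> are the group numbers, labels \<open>d + t\<close> the positions within the group.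
    Positions in a class are spread evenly within each color and group of that class.\<close>
  define \<kappa> where "\<kappa> t = (if t < d then a (Suc t) else b (Suc (t - d)))" for t
  define P where "P t = (if t < d then {} else {t - d})" for t
  have \<kappa>pos: "\<kappa> t > 0" if "t < 2 * d" for t using a_pos b_pos that by (auto simp: \<kappa>_def)
  have Psub: "P t \<subseteq> {..<t}" for t using \<open>d > 0\<close> by (auto simp: P_def)
  have \<kappa>a: "\<kappa> (i - 1) = a i" and \<kappa>b: "\<kappa> (d + i - 1) = b i"
    and P1: "P (i - 1) = {}" and P2: "P (d + i - 1) = {i - 1}" if "i \<in> ?I" for i
    using that by (auto simp: \<kappa>_def P_def Suc_diff_le)
  have prod_shift: "(\<Prod>t < d. h (Suc t)) = (\<Prod>i \<in> ?I. h i)" for h :: "nat \<Rightarrow> nat"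
    using prod.atLeast1_atMost_eq[of h d] by simp
  have prod_d: "(\<Prod>t < d. \<kappa> t) = n"
    unfolding assms(5) prod_shift[symmetric] by (intro prod.cong) (auto simp: \<kappa>_def)
  have prod_2d: "(\<Prod>t < 2 * d. \<kappa> t) = n ^ d"
  proof -
    have "(\<Prod>t < 2 * d. \<kappa> t) = (\<Prod>t < d. \<kappa> t) * (\<Prod>t < d. \<kappa> (d + t))"
    proof -
      have "(\<Prod>t < d + r. \<kappa> t) = (\<Prod>t < d. \<kappa> t) * (\<Prod>t < r. \<kappa> (d + t))" for r
        by (induction r) (simp_all add: mult.assoc)
      then show ?thesis by (simp add: mult_2)
    qed
    also have "\<dots> = (\<Prod>t < d. a (Suc t) * b (Suc t))"
      unfolding prod.distrib by (intro arg_cong2[of _ _ _ _ "(*)"] prod.cong) (auto simp: \<kappa>_def)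
    also have "\<dots> = (\<Prod>t < d. n)" using ab by (intro prod.cong) auto
    finally show ?thesis by simp
  qed
  obtain g where g: "equitable_labelling X fst \<kappa> P (2 * d) g"
    using iterated_equitable_labelling[OF finX, of "2 * d" \<kappa> P fst] \<kappa>pos Psub by blast
  have g\<kappa>: "g x t < \<kappa> t" if "x \<in> X" "t < 2 * d" for x t
    using g that unfolding equitable_labelling_def by blast
  have gstep: "near_quotient (card {x \<in> X. fst x = j \<and> (\<forall>s \<in> P t. g x s = y s) \<and> g x t = y t})
         (card {x \<in> X. fst x = j \<and> (\<forall>s \<in> P t. g x s = y s)}) (\<kappa> t)"
    if "t < 2 * d" "y t < \<kappa> t" for t j y
    using g that unfolding equitable_labelling_def by blast
  have gall: "near_quotient (card {x \<in> X. \<forall>s < t. g x s = y s}) (card X) (\<Prod>s < t. \<kappa> s)"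
    if "t \<le> 2 * d" "\<forall>s < t. y s < \<kappa> s" for t y
    using g that unfolding equitable_labelling_def by blast
  have gcol: "near_quotient (card {x \<in> X. fst x = j \<and> (\<forall>s < t. g x s = y s)})
         (card {x \<in> X. fst x = j}) (\<Prod>s < t. \<kappa> s)"
    if "t \<le> 2 * d" "\<forall>s < t. y s < \<kappa> s" for t y j
    using g that unfolding equitable_labelling_def by blast
  have colX: "card {x \<in> X. fst x = j} = m j" if "j \<in> {1..k}" for j
    unfolding X_def using that by (rule card_items_of_color)

  define c where "c x = (\<lambda>i \<in> ?I. \<nu> i (g x (i - 1)) (g x (d + i - 1)))" for x
  define \<phi> where "\<phi> x = c x ` ?I" for x
  have ga: "g x (i - 1) < a i" and gb: "g x (d + i - 1) < b i" if "x \<in> X" "i \<in> ?I" for x i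
    using g\<kappa>[OF that(1), of "i - 1"] g\<kappa>[OF that(1), of "d + i - 1"] \<kappa>a[OF that(2)] \<kappa>b[OF that(2)] that(2)
    by auto
  have ci: "c x i = \<nu> i (g x (i - 1)) (g x (d + i - 1))" if "i \<in> ?I" for x i
    using that by (simp add: c_def)
  have cT: "c x \<in> ?T" if "x \<in> X" for x
    using \<nu>V ga gb that by (auto simp: c_def)

  \<comment> \<open>An edge fixes all \<open>2 d\<close> labels of the items above it.\<close>
  have type_of: "\<exists>y. (\<forall>s < 2 * d. y s < \<kappa> s) \<and> (\<forall>x \<in> X. \<phi> x = e \<longleftrightarrow> (\<forall>s < 2 * d. g x s = y s))"
    if e: "e \<in> ?E" for e
  proof -
    obtain c' where c': "c' \<in> ?T" "e = c' ` ?I" using e by blast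
    have "\<forall>i \<in> ?I. \<exists>sw. fst sw < a i \<and> snd sw < b i \<and> \<nu> i (fst sw) (snd sw) = c' i"
      using \<nu>surj c'(1) by (fastforce simp: PiE_iff)
    then obtain z where z: "\<And>i. i \<in> ?I \<Longrightarrow> fst (z i) < a i \<and> snd (z i) < b i \<and> \<nu> i (fst (z i)) (snd (z i)) = c' i"
      by metis
    define y where "y t = (if t < d then fst (z (Suc t)) else snd (z (Suc (t - d))))" for t
    have "y t < \<kappa> t" if "t < 2 * d" for t
      using z[of "Suc t"] z[of "Suc (t - d)"] that by (auto simp: y_def \<kappa>_def)
    moreover have "\<phi> x = e \<longleftrightarrow> (\<forall>t < 2 * d. g x t = y t)" if x: "x \<in> X" for x
    proof -
      have "\<phi> x = e \<longleftrightarrow> c x = c'"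
        unfolding \<phi>_def c'(2) using inj_on_eq_iff[OF inj_on_transversal[OF assms(7)] cT[OF x] c'(1)] .
      also have "\<dots> \<longleftrightarrow> (\<forall>i \<in> ?I. c x i = c' i)"
        using PiE_ext[OF cT[OF x] c'(1)] by auto
      also have "\<dots> \<longleftrightarrow> (\<forall>i \<in> ?I. g x (i - 1) = y (i - 1) \<and> g x (d + i - 1) = y (d + i - 1))"
      proof (intro ball_cong refl)
        fix i assume i: "i \<in> ?I"
        then have "y (i - 1) = fst (z i)" "y (d + i - 1) = snd (z i)"
          by (auto simp: y_def Suc_diff_le)
        moreover have "c' i = \<nu> i (fst (z i)) (snd (z i))" using z[OF i] by simp
        ultimately show "c x i = c' i \<longleftrightarrow> g x (i - 1) = y (i - 1) \<and> g x (d + i - 1) = y (d + i - 1)"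
          using ci[OF i] \<nu>inj[OF i ga[OF x i] gb[OF x i], of "fst (z i)" "snd (z i)"] z[OF i] by simp
      qed
      also have "\<dots> \<longleftrightarrow> (\<forall>t < 2 * d. g x t = y t)"
      proof safe
        fix t assume t: "t < 2 * d"
          and all: "\<forall>i \<in> ?I. g x (i - 1) = y (i - 1) \<and> g x (d + i - 1) = y (d + i - 1)"
        show "g x t = y t"
        proof (cases "t < d")
          case True
          then show ?thesis using all[rule_format, of "Suc t"] by simp
        next
          case False
          then show ?thesis using all[rule_format, of "Suc (t - d)"] t by simp
        qed
      qed auto
      finally show ?thesis .
    qed
    ultimately show ?thesis by blast
  qed

  have multG: "edge_mult G e = (if e \<in> ?E then lam else 0)" for e
    unfolding assms(9,10) using edge_mult_scaled_complete_partite[OF assms(7) finV] by simp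
  have \<phi>E: "\<phi> x \<in> ?E" if "x \<in> X" for x using cT[OF that] by (auto simp: \<phi>_def)
  have fibre: "card {x \<in> X. \<phi> x = e} = edge_mult G e" for e
  proof (cases "e \<in> ?E")
    case True
    from type_of[OF True] obtain y where "(\<forall>s < 2 * d. y s < \<kappa> s) \<and>
      (\<forall>x \<in> X. \<phi> x = e \<longleftrightarrow> (\<forall>s < 2 * d. g x s = y s))" ..
    then have y: "\<forall>s < 2 * d. y s < \<kappa> s" "\<And>x. x \<in> X \<Longrightarrow> \<phi> x = e \<longleftrightarrow> (\<forall>s < 2 * d. g x s = y s)"
      by simp_all
    have "{x \<in> X. \<phi> x = e} = {x \<in> X. \<forall>s < 2 * d. g x s = y s}"
      using y(2) by (intro Collect_cong conj_cong refl)
    then have "near_quotient (card {x \<in> X. \<phi> x = e}) (lam * n ^ d) (n ^ d)"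
      using gall[OF _ y(1)] by (simp add: prod_2d cardX)
    then show ?thesis using near_quotient_exact True by (simp add: multG)
  next
    case False
    then have "{x \<in> X. \<phi> x = e} = {}" using \<phi>E by blast
    then show ?thesis using False by (simp only: multG card.empty if_False)
  qed
  obtain f where f: "\<forall>p \<in> occurrences G. f p \<in> fst ` X"
    and count: "\<And>j Q. card {p \<in> occurrences G. f p = j \<and> Q (fst p)} = card {x \<in> X. fst x = j \<and> Q (\<phi> x)}"
    using coloring_from_items[OF finX fibre, of fst] by blast

  have coloring: "is_coloring G k f" using f by (auto simp: is_coloring_def X_def)
  have size: "num_edges (color_class G f j) = m j" if j: "j \<in> {1..k}" for j
    using count[of j "\<lambda>_. True"] colX[OF j] by (simp add: num_edges_color_class)
  have degree: "real (vertex_degree (color_class G f j) v) \<approx>\<^sub>r real (m j) / real n"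
    if j: "j \<in> {1..k}" and v: "v \<in> verts G" for j v
  proof (rule near_quotient_imp_approx[OF _ n_pos])
    obtain i where i: "i \<in> ?I" "v \<in> V i"
      using v by (auto simp: assms(9,10) scale_hypergraph_def complete_partite_def)
    obtain s w where sw: "s < a i" "w < b i" "\<nu> i s w = v" using \<nu>surj[OF i] by blast
    define y where "y t = (if t = i - 1 then s else w)" for t
    have y: "y (i - 1) = s" "y (d + i - 1) = w" using i(1) by (auto simp: y_def)
    have lt: "i - 1 < 2 * d" "d + i - 1 < 2 * d" using i(1) by auto
    have "v \<in> \<phi> x \<longleftrightarrow> g x (i - 1) = s \<and> g x (d + i - 1) = w" if x: "x \<in> X" for x
      using mem_transversal_iff[OF assms(7) cT[OF x] i] ci[OF i(1), of x] sw
        \<nu>inj[OF i(1) ga[OF x i(1)] gb[OF x i(1)] sw(1,2)] by (simp add: \<phi>_def)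
    then have deg: "vertex_degree (color_class G f j) v
        = card {x \<in> X. fst x = j \<and> g x (i - 1) = s \<and> g x (d + i - 1) = w}"
      unfolding vertex_degree_color_class count by (intro arg_cong[of _ _ card]) auto
    \<comment> \<open>First the group of \<open>v\<close> receives its share of color \<open>j\<close>, then \<open>v\<close> its share of the group.\<close>
    have outer: "near_quotient (card {x \<in> X. fst x = j \<and> g x (i - 1) = s}) (m j) (a i)"
      using gstep[OF lt(1), of y j] \<kappa>a[OF i(1)] P1[OF i(1)] sw(1) y colX[OF j] by simp
    have inner: "near_quotient (card {x \<in> X. fst x = j \<and> g x (i - 1) = s \<and> g x (d + i - 1) = w})
        (card {x \<in> X. fst x = j \<and> g x (i - 1) = s}) (b i)"
      using gstep[OF lt(2), of y j] unfolding \<kappa>b[OF i(1)] P2[OF i(1)] y using sw(2) y by simp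
    show "near_quotient (vertex_degree (color_class G f j) v) (m j) n"
      using near_quotient_trans[OF outer inner] unfolding deg ab[OF i(1)] .
  qed
  have block: "real (color_count_in G f j B) \<approx>\<^sub>r real (m j) / real n"
    if j: "j \<in> {1..k}" and B: "B \<in> blocks G d a U" for j B
  proof (rule near_quotient_imp_approx[OF _ n_pos])
    obtain s where s: "\<And>i. i \<in> ?I \<Longrightarrow> s i \<in> {1..a i}"
      and B: "B = induced_hypergraph G (\<Union>i \<in> ?I. U i (s i))"
      using B unfolding blocks_def by blast
    \<comment> \<open>Lying in a block is a condition on the first \<open>d\<close> labels.\<close>
    define y where "y t = s (Suc t) - 1" for t
    have y: "\<forall>t < d. y t < \<kappa> t"
    proof (intro allI impI)
      fix t assume "t < d"
      then show "y t < \<kappa> t" using s[of "Suc t"] by (auto simp: y_def \<kappa>_def)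
    qed
    have "\<phi> x \<subseteq> (\<Union>i \<in> ?I. U i (s i)) \<longleftrightarrow> (\<forall>t < d. g x t = y t)" if x: "x \<in> X" for x
    proof -
      have "\<phi> x \<subseteq> (\<Union>i \<in> ?I. U i (s i)) \<longleftrightarrow> (\<forall>i \<in> ?I. c x i \<in> U i (s i))"
        unfolding \<phi>_def using UV s by (intro transversal_subset_iff[OF assms(7) cT[OF x]]) blast
      also have "\<dots> \<longleftrightarrow> (\<forall>i \<in> ?I. Suc (g x (i - 1)) = s i)"
        using ci \<nu>group ga[OF x] gb[OF x] s by (intro ball_cong refl) simp
      also have "\<dots> \<longleftrightarrow> (\<forall>t < d. Suc (g x t) = s (Suc t))"
      proof safe
        fix i assume all: "\<forall>t < d. Suc (g x t) = s (Suc t)" and i: "i \<in> ?I"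
        then show "Suc (g x (i - 1)) = s i" using all[rule_format, of "i - 1"] by auto
      next
        fix t assume all: "\<forall>i \<in> ?I. Suc (g x (i - 1)) = s i" and t: "t < d"
        then show "Suc (g x t) = s (Suc t)" using all[rule_format, of "Suc t"] by simp
      qed
      also have "\<dots> \<longleftrightarrow> (\<forall>t < d. g x t = y t)"
      proof (intro all_cong)
        fix t assume "t < d"
        then show "Suc (g x t) = s (Suc t) \<longleftrightarrow> g x t = y t" using s[of "Suc t"] by (auto simp: y_def)
      qed
      finally show ?thesis .
    qed
    then have "color_count_in G f j B = card {x \<in> X. fst x = j \<and> (\<forall>t < d. g x t = y t)}"
      unfolding B color_count_in_induced count[of j "\<lambda>e. e \<subseteq> (\<Union>i \<in> ?I. U i (s i))"]
      by (intro arg_cong[of _ _ card]) auto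
    then show "near_quotient (color_count_in G f j B) (m j) n"
      using gcol[OF _ y, of j] by (simp add: prod_d colX[OF j])
  qed
  have mult: "near_quotient (edge_mult (color_class G f j) e) (m j) (n ^ d)"
    if j: "j \<in> {1..k}" and e: "e \<in> ?E" for j e
  proof -
    from type_of[OF e] obtain y where "(\<forall>s < 2 * d. y s < \<kappa> s) \<and>
      (\<forall>x \<in> X. \<phi> x = e \<longleftrightarrow> (\<forall>s < 2 * d. g x s = y s))" ..
    then have y: "\<forall>s < 2 * d. y s < \<kappa> s" "\<And>x. x \<in> X \<Longrightarrow> \<phi> x = e \<longleftrightarrow> (\<forall>s < 2 * d. g x s = y s)"
      by simp_all
    have "edge_mult (color_class G f j) e = card {x \<in> X. fst x = j \<and> (\<forall>s < 2 * d. g x s = y s)}"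
      unfolding edge_mult_color_class count[of j "\<lambda>e'. e' = e"]
      using y(2) by (intro arg_cong[of _ _ card] Collect_cong conj_cong refl)
    then show ?thesis using gcol[OF _ y(1), of j] by (simp add: prod_2d colX[OF j])
  qed
  have edge: "e \<in> ?E" if "e \<in># edges K" for e
    using that finT unfolding assms(9) complete_partite_def by simp
  have simple: "simple_hypergraph (color_class G f j) \<longleftrightarrow> m j \<le> n ^ d" if j: "j \<in> {1..k}" for j
  proof
    assume simple: "simple_hypergraph (color_class G f j)"
    \<comment> \<open>Without repeated edges, the items of color \<open>j\<close> lie above distinct edges, of which there are \<open>n\<^sup>d\<close>.\<close>
    have "inj_on \<phi> {x \<in> X. fst x = j}"
    proof (rule inj_onI)
      fix x x' assume x: "x \<in> {x \<in> X. fst x = j}" "x' \<in> {x \<in> X. fst x = j}" "\<phi> x = \<phi> x'"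
      have "card {z \<in> X. fst z = j \<and> \<phi> z = \<phi> x} \<le> Suc 0"
        unfolding count[of j "\<lambda>e'. e' = \<phi> x", symmetric] edge_mult_color_class[symmetric]
        using simple by (simp add: simple_hypergraph_def)
      then have unique: "\<forall>z \<in> {z \<in> X. fst z = j \<and> \<phi> z = \<phi> x}. \<forall>z' \<in> {z \<in> X. fst z = j \<and> \<phi> z = \<phi> x}. z = z'"
        using finX by (subst (asm) card_le_Suc0_iff_eq) auto
      show "x = x'"
        by (rule unique[THEN bspec, THEN bspec]) (use x in simp_all)
    qed
    then have "m j = card (\<phi> ` {x \<in> X. fst x = j})" using colX[OF j] by (simp add: card_image)
    also have "\<dots> \<le> card ?E"
      using \<phi>E by (intro card_mono finite_imageI finT) auto
    also have "\<dots> \<le> card ?T" using finT by (rule card_image_le)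
    also have "\<dots> = (\<Prod>i \<in> ?I. n)" using assms(8) by (subst card_PiE) auto
    finally show "m j \<le> n ^ d" by simp
  next
    assume le: "m j \<le> n ^ d"
    show "simple_hypergraph (color_class G f j)"
      unfolding simple_hypergraph_def
    proof
      fix e
      show "edge_mult (color_class G f j) e \<le> 1"
      proof (cases "e \<in> ?E")
        case True
        \<comment> \<open>The estimate \<open>mult < m\<^sub>j / n\<^sup>d + 1\<close> leaves only \<open>mult \<le> 1\<close>.\<close>
        have "n ^ d * edge_mult (color_class G f j) e < m j + n ^ d"
          using mult[OF j True] unfolding near_quotient_def by (rule conjunct1)
        also have "\<dots> \<le> n ^ d * 2" using le by simp
        finally have "edge_mult (color_class G f j) e < 2" by (simp only: mult_less_cancel1)
        then show ?thesis by simp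
      next
        case False
        then have empty: "{x \<in> X. fst x = j \<and> \<phi> x = e} = {}" using \<phi>E by blast
        show ?thesis unfolding edge_mult_color_class count[of j "\<lambda>e'. e' = e"] empty by simp
      qed
    qed
  qed
  show ?thesis
  proof (intro exI[of _ f] conjI ballI)
    fix j e assume "j \<in> {1..k}" "e \<in># edges K"
    then show "real (edge_mult (color_class G f j) e) \<approx>\<^sub>r real (m j) / real (n ^ d)"
      using near_quotient_imp_approx[OF mult] edge n_pos by simp
  qed (fact coloring size degree block simple)+
qed

end
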